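(* The chromatic number is stable under 2-switch: for every graph $G$ and every 2-switch $\tau$, $|\chi(\tau(G))-\chi(G)|\le 1$.
   Context: Graphs are finite, simple, undirected and labeled. $\chi(G)$ is the chromatic number of $G$. For vertices $a,b,c,d$, the 2-switch $\tau=\binom{a\ b}{c\ d}$ maps $G$ to $G-ab-cd+ac+bd$ if $ab,cd\in E(G)$, $\{a,b\}\cap\{c,d\}=\varnothing$ and $ac,bd\notin E(G)$, and to $G$ otherwise. *)

theory Defs
  imports "Graph_Theory.Pair_Digraph"
begin

text \<open>
  A finite simple undirected graph is a \<open>pair_graph\<close>: a finite, loop-free and symmetric
  arc relation, in which the edge \<open>uv\<close> is represented by the two arcs \<open>(u, v)\<close> and \<open>(v, u)\<close>.
  Labeled means that graphs are compared as they are, not up to isomorphism.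
\<close>

definition edge_arcs :: "'a \<Rightarrow> 'a \<Rightarrow> 'a rel" where
  "edge_arcs u v = {(u, v), (v, u)}"

definition proper_coloring :: "'a pair_pre_digraph \<Rightarrow> nat \<Rightarrow> ('a \<Rightarrow> nat) \<Rightarrow> bool" where
  "proper_coloring G k f \<longleftrightarrow>
     f ` pverts G \<subseteq> {..<k} \<and> (\<forall>(u, v) \<in> parcs G. f u \<noteq> f v)"

definition chromatic_number :: "'a pair_pre_digraph \<Rightarrow> nat" where
  "chromatic_number G = (LEAST k. \<exists>f. proper_coloring G k f)"

definition two_switch ::
  "'a \<Rightarrow> 'a \<Rightarrow> 'a \<Rightarrow> 'a \<Rightarrow> 'a pair_pre_digraph \<Rightarrow> 'a pair_pre_digraph" where
  "two_switch a b c d G =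
     (if (a, b) \<in> parcs G \<and> (c, d) \<in> parcs G \<and> {a, b} \<inter> {c, d} = {} \<and>
         (a, c) \<notin> parcs G \<and> (b, d) \<notin> parcs G
      then G\<lparr>parcs := (parcs G - edge_arcs a b - edge_arcs c d) \<union> edge_arcs a c \<union> edge_arcs b d\<rparr>
      else G)"

text \<open>
  The set of numbers of colours in the definition of \<open>chromatic_number\<close> is nonempty for
  every \<open>pair_graph\<close>, so \<open>LEAST\<close> is attained, and a 2-switch maps graphs to graphs.
\<close>

lemma chromatic_number_attained:
  assumes "pair_graph G"
  shows "\<exists>f. proper_coloring G (chromatic_number G) f"
proof -
  interpret pair_graph G by fact
  obtain f :: "'a \<Rightarrow> nat" and n where f: "f ` pverts G = {i. i < n}" "inj_on f (pverts G)"
    using finite_imp_inj_to_nat_seg[OF pair_finite_verts] by blast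
  have "f u \<noteq> f v" if "(u, v) \<in> parcs G" for u v
    using that f(2) no_loops' in_arcsD1 in_arcsD2 by (metis inj_onD)
  then have "proper_coloring G n f"
    using f(1) by (auto simp: proper_coloring_def)
  then have "\<exists>k f. proper_coloring G k f" by blast
  then show ?thesis
    unfolding chromatic_number_def by (rule LeastI_ex)
qed

lemma pair_graph_two_switch:
  assumes "pair_graph G"
  shows "pair_graph (two_switch a b c d G)"
proof -
  interpret pair_graph G by fact
  have symG: "(v, u) \<in> parcs G" if "(u, v) \<in> parcs G" for u v
    using that pair_sym_arcs by (auto simp: symmetric_def dest: symD)
  show ?thesis
  proof (cases "two_switch a b c d G = G")
    case True
    then show ?thesis using assms by simp
  next
    case False
    then have ab: "(a, b) \<in> parcs G" and cd: "(c, d) \<in> parcs G"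
      and disj: "a \<noteq> c" "b \<noteq> d"
      by (auto simp: two_switch_def split: if_splits)
    have verts: "pverts (two_switch a b c d G) = pverts G"
      by (simp add: two_switch_def)
    have arcs: "parcs (two_switch a b c d G) =
        (parcs G - edge_arcs a b - edge_arcs c d) \<union> edge_arcs a c \<union> edge_arcs b d"
      using False by (auto simp: two_switch_def split: if_splits)
    have in_verts: "a \<in> pverts G" "b \<in> pverts G" "c \<in> pverts G" "d \<in> pverts G"
      using ab cd in_arcsD1 in_arcsD2 by blast+
    have "sym (parcs (two_switch a b c d G))"
      unfolding arcs by (rule symI) (auto simp: edge_arcs_def symG)
    moreover have "u \<noteq> v" if "(u, v) \<in> parcs (two_switch a b c d G)" for u v
      using that disj no_loops' unfolding arcs edge_arcs_def by auto
    moreover have "u \<in> pverts G \<and> v \<in> pverts G"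
      if "(u, v) \<in> parcs (two_switch a b c d G)" for u v
      using that in_verts in_arcsD1 in_arcsD2 unfolding arcs edge_arcs_def by auto
    moreover have "finite (parcs (two_switch a b c d G))"
      unfolding arcs using pair_finite_arcs by (auto simp: edge_arcs_def)
    ultimately show ?thesis
      by unfold_locales
        (use pair_finite_verts in \<open>auto simp: verts symmetric_def\<close>)
  qed
qed

end

theory Submission
  imports Defs
begin

text \<open>
  If two graphs on the same vertices differ only in edges that meet a set \<open>S\<close>, and \<open>S\<close> is
  independent in one of them, then a colouring of the other becomes a colouring of this one when
  \<open>S\<close> is given a single new colour. All four edges of a 2-switch meet \<open>{a, b}\<close>, which is
  independent after the switch, and all of them meet \<open>{a, c}\<close>, which is independent before it.
\<close>

lemma chromatic_number_le:
  assumes "proper_coloring G k f"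
  shows "chromatic_number G \<le> k"
  unfolding chromatic_number_def using assms by (blast intro: Least_le)

lemma chromatic_number_le_Suc_outside_independent:
  assumes G: "pair_graph G" and H: "pair_graph H"
    and verts: "pverts H = pverts G"
    and indep: "\<And>u v. (u, v) \<in> parcs H \<Longrightarrow> \<not> (u \<in> S \<and> v \<in> S)"
    and outside: "\<And>u v. (u, v) \<in> parcs H \<Longrightarrow> u \<notin> S \<Longrightarrow> v \<notin> S \<Longrightarrow> (u, v) \<in> parcs G"
  shows "chromatic_number H \<le> Suc (chromatic_number G)"
proof -
  interpret H: pair_graph H by fact
  define k where "k = chromatic_number G"
  obtain f where f: "proper_coloring G k f"
    using chromatic_number_attained[OF G] unfolding k_def by blast
  have less: "f v < k" if "v \<in> pverts G" for v
    using f that by (auto simp: proper_coloring_def)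
  have proper: "f u \<noteq> f v" if "(u, v) \<in> parcs G" for u v
    using f that by (auto simp: proper_coloring_def)
  \<comment> \<open>The colours of \<open>f\<close> on vertices lie below \<open>k\<close>, so
    \<open>k\<close> is new: an arc with one end in \<open>S\<close> is safe, and only arcs inside
    or outside \<open>S\<close> need the hypotheses.\<close>
  define g where "g v = (if v \<in> S then k else f v)" for v
  have "g u \<noteq> g v" if uv: "(u, v) \<in> parcs H" for u v
  proof -
    have "f u < k" "f v < k"
      using uv H.in_arcsD1 H.in_arcsD2 less verts by auto
    then show ?thesis
      using indep[OF uv] outside[OF uv] proper by (auto simp: g_def)
  qed
  moreover have "g v < Suc k" if "v \<in> pverts H" for v
    using less that verts by (auto simp: g_def less_SucI)
  ultimately have "proper_coloring H (Suc k) g"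
    by (auto simp: proper_coloring_def)
  then show ?thesis
    unfolding k_def by (rule chromatic_number_le)
qed

theorem theorem13:
  fixes G :: "'a pair_pre_digraph" and a b c d :: 'a
  assumes "pair_graph G"
  shows "\<bar>int (chromatic_number (two_switch a b c d G)) - int (chromatic_number G)\<bar> \<le> 1"
proof (cases "two_switch a b c d G = G")
  case True
  then show ?thesis by simp
next
  case False
  define H where "H = two_switch a b c d G"
  interpret G: pair_graph G by fact
  have H: "pair_graph H"
    unfolding H_def using assms by (rule pair_graph_two_switch)
  have disj: "a \<noteq> c" "a \<noteq> d" "b \<noteq> c" "b \<noteq> d" and ac: "(a, c) \<notin> parcs G"
    using False by (auto simp: two_switch_def split: if_splits)
  have ca: "(c, a) \<notin> parcs G"
    using ac G.pair_sym_arcs by (auto simp: symmetric_def dest: symD)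
  have verts: "pverts H = pverts G"
    by (simp add: H_def two_switch_def)
  have arcs: "parcs H =
      (parcs G - edge_arcs a b - edge_arcs c d) \<union> edge_arcs a c \<union> edge_arcs b d"
    using False by (auto simp: H_def two_switch_def split: if_splits)
  \<comment> \<open>The switch deletes \<open>ab\<close>, and by \<open>disj\<close> neither new
    edge restores it; each new edge has an end in \<open>{a, b}\<close>.\<close>
  have "chromatic_number H \<le> Suc (chromatic_number G)"
    by (rule chromatic_number_le_Suc_outside_independent[OF assms H verts, where S = "{a, b}"])
      (use disj G.no_loops' in \<open>auto simp: arcs edge_arcs_def\<close>)
  \<comment> \<open>Here the non-edge \<open>ac\<close> of \<open>G\<close> gives independence,
    needed for both arc directions; the deleted edges \<open>ab\<close> and \<open>cd\<close> meet
    \<open>{a, c}\<close>, so every other arc of \<open>G\<close> survives in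
    \<open>H\<close>.\<close>
  moreover have "chromatic_number G \<le> Suc (chromatic_number H)"
    by (rule chromatic_number_le_Suc_outside_independent[OF H assms verts[symmetric],
          where S = "{a, c}"])
      (use ac ca G.no_loops' in \<open>auto simp: arcs edge_arcs_def\<close>)
  ultimately show ?thesis
    unfolding H_def by linarith
qed

end
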